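(* If $A\in 2^\omega$ is $1$-generic, then the many-one degree $\deg_m(A)$ contains an infinite antichain of $1$-degrees; that is, there is an infinite sequence $(B_i)_{i\in\omega}$ of subsets of $\omega$ such that $B_i\equiv_m A$ for every $i$ and $B_i\not\le_1 B_j$ for all $i\neq j$.
   Context: $\omega=\{0,1,2,\dots\}$; sets $A\subseteq\omega$ are identified with their characteristic functions in Cantor space $2^\omega$, and $2^{<\omega}$ is the set of finite binary strings. A set $A\in 2^\omega$ is $1$-generic if for every computably enumerable set of strings $W\subseteq 2^{<\omega}$ there exists an initial segment $\sigma$ of $A$ such that either $\sigma\in W$, or no extension of $\sigma$ belongs to $W$. For $A,B\subseteq\omega$: $A\le_m B$ if there is a total computable function $f:\omega\to\omega$ such that for all $x$, $x\in A\iff f(x)\in B$; $A\le_1 B$ if there is such an $f$ which is moreover injective. $A\equiv_m B$ means $A\le_m B$ and $B\le_m A$; $A\equiv_1 B$ means $A\le_1 B$ and $B\le_1 A$. $\deg_m(A)=\{X\subseteq\omega: X\equiv_m A\}$ and $\deg_1(A)=\{X\subseteq\omega: X\equiv_1 A\}$. *)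

theory Defs
  imports "HOL-Library.Sublist"
begin

section \<open>Partial recursive functions\<close>

text \<open>
  Kleene's \<open>\<mu>\<close>-recursive functions. Arities are not recorded in the syntax: a term is evaluated on
  an argument list of any length, with surplus arguments ignored and missing ones making the result
  undefined. For each fixed length of the argument list the terms denote exactly the partial
  recursive functions of that arity.
\<close>

datatype recf =
    Zero
  | Succ
  | Proj nat
  | Comp recf "recf list"
  | PrimRec recf recf
  | Mu recf

text \<open>
  Composition is strict in all arguments. In \<open>PrimRec f g\<close> the recursion runs over the first argument,
  and \<open>g\<close> receives the predecessor, the previous value and the parameters. \<open>Mu f\<close> requires \<open>f\<close> to be
  defined on all values below the zero that is found.
\<close>

fun eval :: "recf \<Rightarrow> nat list \<Rightarrow> nat option" where
  "eval Zero xs = Some 0"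
| "eval Succ xs = (case xs of [] \<Rightarrow> None | x # _ \<Rightarrow> Some (Suc x))"
| "eval (Proj i) xs = (if i < length xs then Some (xs ! i) else None)"
| "eval (Comp f gs) xs =
     (if \<forall>g\<in>set gs. eval g xs \<noteq> None then eval f (map (\<lambda>g. the (eval g xs)) gs) else None)"
| "eval (PrimRec f g) xs =
     (case xs of
        [] \<Rightarrow> None
      | n # ys \<Rightarrow> rec_nat (eval f ys) (\<lambda>k r. Option.bind r (\<lambda>v. eval g (k # v # ys))) n)"
| "eval (Mu f) xs =
     (if \<exists>z. eval f (z # xs) = Some 0 \<and> (\<forall>y<z. eval f (y # xs) \<noteq> None)
      then Some (LEAST z. eval f (z # xs) = Some 0) else None)"

definition partial_computable :: "(nat \<Rightarrow> nat option) \<Rightarrow> bool" where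
  "partial_computable \<phi> \<longleftrightarrow> (\<exists>p. \<forall>x. eval p [x] = \<phi> x)"

definition computable :: "(nat \<Rightarrow> nat) \<Rightarrow> bool" where
  "computable f \<longleftrightarrow> partial_computable (\<lambda>x. Some (f x))"

definition ce :: "nat set \<Rightarrow> bool" where
  "ce S \<longleftrightarrow> (\<exists>\<phi>. partial_computable \<phi> \<and> S = dom \<phi>)"

section \<open>Binary strings and 1-genericity\<close>

text \<open>
  Strings are coded by bijective base-2 numeration (digits 1 for \<open>False\<close> and 2 for \<open>True\<close>), with
  the first bit of the string as the least significant digit.
\<close>

fun str_code :: "bool list \<Rightarrow> nat" where
  "str_code [] = 0"
| "str_code (b # \<sigma>) = 2 * str_code \<sigma> + (if b then 2 else 1)"

lemma bij_str_code: "bij str_code"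
proof (rule bijI)
  show "inj str_code"
  proof (rule injI)
    fix \<sigma> \<tau> :: "bool list"
    assume "str_code \<sigma> = str_code \<tau>"
    then show "\<sigma> = \<tau>"
    proof (induction \<sigma> arbitrary: \<tau>)
      case Nil
      then show ?case by (cases \<tau>) (auto split: if_splits)
    next
      case (Cons b \<sigma>)
      then obtain c \<rho> where \<tau>: "\<tau> = c # \<rho>"
        by (cases \<tau>) (auto split: if_splits)
      with Cons.prems have eq:
        "2 * str_code \<sigma> + (if b then 2 else 1) = 2 * str_code \<rho> + (if c then 2 else 1)"
        by simp
      then have "b = c" by (cases b; cases c; simp; presburger)
      with eq \<tau> Cons.IH show ?case by simp
    qed
  qed
  have "\<exists>\<sigma>. str_code \<sigma> = n" for n
  proof (induction n rule: less_induct)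
    case (less n)
    show ?case
    proof (cases "n = 0")
      case True
      then show ?thesis by (metis str_code.simps(1))
    next
      case False
      then obtain \<sigma> where \<sigma>: "str_code \<sigma> = (n - 1) div 2"
        using less.IH[of "(n - 1) div 2"] by fastforce
      have "str_code (even n # \<sigma>) = n"
        using False \<sigma> by (simp; presburger)
      then show ?thesis ..
    qed
  qed
  then show "surj str_code" by (metis surjI)
qed

definition ce_strings :: "bool list set \<Rightarrow> bool" where
  "ce_strings W \<longleftrightarrow> ce (str_code ` W)"

definition initial_segment :: "nat set \<Rightarrow> nat \<Rightarrow> bool list" where
  "initial_segment A n = map (\<lambda>i. i \<in> A) [0..<n]"

definition one_generic :: "nat set \<Rightarrow> bool" where
  "one_generic A \<longleftrightarrow>
     (\<forall>W. ce_strings W \<longrightarrow>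
        (\<exists>n. initial_segment A n \<in> W \<or> (\<forall>\<tau>. prefix (initial_segment A n) \<tau> \<longrightarrow> \<tau> \<notin> W)))"

section \<open>Reducibilities and degrees\<close>

definition many_one_reducible :: "nat set \<Rightarrow> nat set \<Rightarrow> bool" (infix "\<le>\<^sub>m" 50) where
  "A \<le>\<^sub>m B \<longleftrightarrow> (\<exists>f. computable f \<and> (\<forall>x. x \<in> A \<longleftrightarrow> f x \<in> B))"

definition one_one_reducible :: "nat set \<Rightarrow> nat set \<Rightarrow> bool" (infix "\<le>\<^sub>1" 50) where
  "A \<le>\<^sub>1 B \<longleftrightarrow> (\<exists>f. computable f \<and> inj f \<and> (\<forall>x. x \<in> A \<longleftrightarrow> f x \<in> B))"

definition many_one_equiv :: "nat set \<Rightarrow> nat set \<Rightarrow> bool" (infix "\<equiv>\<^sub>m" 50) where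
  "A \<equiv>\<^sub>m B \<longleftrightarrow> A \<le>\<^sub>m B \<and> B \<le>\<^sub>m A"

definition many_one_degree :: "nat set \<Rightarrow> nat set set" where
  "many_one_degree A = {X. X \<equiv>\<^sub>m A}"

end

theory Submission imports Defs begin

text \<open>
  If \<open>g\<close> and \<open>h\<close> are computable and \<open>g y \<in> A \<longleftrightarrow> h y \<in> A\<close> for all \<open>y\<close>, then a 1-generic \<open>A\<close> avoids
  the c.e. set of strings that take different values at \<open>g y\<close> and \<open>h y\<close> for some \<open>y\<close>. Hence some
  initial segment of length \<open>n\<close> cannot be extended into that set, which forces \<open>g y = h y\<close> unless
  both values lie below \<open>n\<close>.

  Let \<open>g\<^sub>i\<close> be a computable surjection whose fibre over \<open>x\<close> has two elements if \<open>x = 2 ^ i * y\<close> with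
  \<open>y\<close> odd, and one element otherwise, and let \<open>B\<^sub>i\<close> be the preimage of \<open>A\<close> under \<open>g\<^sub>i\<close>. By the
  above, a 1-reduction from \<open>B\<^sub>i\<close> to \<open>B\<^sub>j\<close> embeds the \<open>g\<^sub>i\<close>-fibre over \<open>x\<close> into the \<open>g\<^sub>j\<close>-fibre
  over \<open>x\<close> for all large \<open>x\<close>, which is impossible for \<open>i \<noteq> j\<close>.
\<close>

section \<open>Closure properties of total recursive functions\<close>

text \<open>The arity is the length of the list, so functions of any arity have the same type and
  the closure rules below apply by recursion on the body of \<open>F\<close>.\<close>

definition total_rec :: "nat \<Rightarrow> (nat list \<Rightarrow> nat) \<Rightarrow> bool" where
  "total_rec n F \<longleftrightarrow> (\<exists>p. \<forall>xs. length xs = n \<longrightarrow> eval p xs = Some (F xs))"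

lemma total_rec_cong:
  assumes "total_rec n F" "\<And>xs. length xs = n \<Longrightarrow> F xs = G xs"
  shows "total_rec n G"
  using assms unfolding total_rec_def by metis

lemma total_rec_Suc_0_iff: "total_rec (Suc 0) F \<longleftrightarrow> computable (\<lambda>x. F [x])"
proof -
  have "(\<forall>xs. length xs = Suc 0 \<longrightarrow> eval p xs = Some (F xs)) \<longleftrightarrow> (\<forall>x. eval p [x] = Some (F [x]))" for p
    by (auto simp: length_Suc_conv)
  then show ?thesis
    unfolding total_rec_def computable_def partial_computable_def by simp
qed

lemma total_rec_zero: "total_rec n (\<lambda>xs. 0)"
  unfolding total_rec_def by (rule exI[of _ Zero]) simp

lemma total_rec_nth: "i < n \<Longrightarrow> total_rec n (\<lambda>xs. xs ! i)"
  unfolding total_rec_def by (rule exI[of _ "Proj i"]) simp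

lemma computable_Suc: "computable Suc"
  unfolding computable_def partial_computable_def by (rule exI[of _ Succ]) simp

lemma total_rec_Comp:
  assumes "total_rec (length Gs) H" "\<And>G. G \<in> set Gs \<Longrightarrow> total_rec n G"
  shows "total_rec n (\<lambda>xs. H (map (\<lambda>G. G xs) Gs))"
proof -
  obtain p where p: "\<And>xs. length xs = length Gs \<Longrightarrow> eval p xs = Some (H xs)"
    using assms(1) unfolding total_rec_def by blast
  obtain q where q: "\<And>G xs. G \<in> set Gs \<Longrightarrow> length xs = n \<Longrightarrow> eval (q G) xs = Some (G xs)"
    using assms(2) unfolding total_rec_def by metis
  have "eval (Comp p (map q Gs)) xs = Some (H (map (\<lambda>G. G xs) Gs))" if "length xs = n" for xs
  proof -
    have "map (\<lambda>g. the (eval g xs)) (map q Gs) = map (\<lambda>G. G xs) Gs"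
      using q that by simp
    then show ?thesis using p q that by (simp del: map_map)
  qed
  then show ?thesis unfolding total_rec_def by blast
qed

lemma total_rec_comp1:
  assumes "computable h" "total_rec n F"
  shows "total_rec n (\<lambda>xs. h (F xs))"
  using total_rec_Comp[of "[F]" "\<lambda>xs. h (xs ! 0)" n] assms
    total_rec_Suc_0_iff[of "\<lambda>xs. h (xs ! 0)"] by simp

lemma total_rec_comp2:
  assumes "total_rec 2 (\<lambda>xs. h (xs ! 0) (xs ! 1))" "total_rec n F" "total_rec n G"
  shows "total_rec n (\<lambda>xs. h (F xs) (G xs))"
  using total_rec_Comp[of "[F, G]" "\<lambda>xs. h (xs ! 0) (xs ! 1)" n] assms
  by (auto simp: numeral_2_eq_2)

lemma total_rec_const: "total_rec n (\<lambda>xs. c)"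
  by (induction c) (auto intro: total_rec_zero total_rec_comp1[OF computable_Suc])

lemma total_rec_PrimRec:
  assumes "total_rec n F" "total_rec (Suc (Suc n)) G"
  shows "total_rec (Suc n) (\<lambda>xs. rec_nat (F (tl xs)) (\<lambda>k r. G (k # r # tl xs)) (hd xs))"
proof -
  obtain p q where p: "\<And>xs. length xs = n \<Longrightarrow> eval p xs = Some (F xs)"
    and q: "\<And>xs. length xs = Suc (Suc n) \<Longrightarrow> eval q xs = Some (G xs)"
    using assms unfolding total_rec_def by metis
  have *: "eval (PrimRec p q) (m # ys) = Some (rec_nat (F ys) (\<lambda>k r. G (k # r # ys)) m)"
    if "length ys = n" for m ys
    using that by (induction m) (auto simp: p q)
  have "eval (PrimRec p q) xs = Some (rec_nat (F (tl xs)) (\<lambda>k r. G (k # r # tl xs)) (hd xs))"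
    if "length xs = Suc n" for xs
    using that *[of "tl xs" "hd xs"] by (cases xs) auto
  then show ?thesis unfolding total_rec_def by blast
qed

lemma computable_rec_nat:
  assumes "total_rec 2 (\<lambda>xs. s (xs ! 0) (xs ! 1))"
  shows "computable (rec_nat c s)"
proof -
  have "total_rec (Suc (Suc 0)) (\<lambda>xs. s (xs ! 0) (xs ! 1))"
    using assms by (simp add: numeral_2_eq_2)
  from total_rec_PrimRec[OF total_rec_const[of 0 c] this]
  show ?thesis by (simp add: total_rec_Suc_0_iff)
qed

text \<open>The number of iterations is itself an argument. This yields addition and, later, the
  dropping of a computed number of bits from a coded string.\<close>

lemma total_rec_iterate:
  assumes "computable s"
  shows "total_rec 2 (\<lambda>xs. (s ^^ (xs ! 0)) (xs ! 1))"
proof -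
  have iter: "rec_nat y (\<lambda>k. s) n = (s ^^ n) y" for n y
    by (induction n) auto
  have "total_rec (Suc (Suc 1)) (\<lambda>xs. s (xs ! 1))"
    by (intro total_rec_comp1[OF assms] total_rec_nth) simp
  from total_rec_PrimRec[OF total_rec_nth[of 0 1] this]
  have "total_rec 2 (\<lambda>xs. rec_nat (tl xs ! 0) (\<lambda>k. s) (hd xs))"
    by (simp add: numeral_2_eq_2)
  then show ?thesis
    by (rule total_rec_cong) (auto simp: iter numeral_2_eq_2 length_Suc_conv)
qed

lemma total_rec_add:
  assumes "total_rec n F" "total_rec n G"
  shows "total_rec n (\<lambda>xs. F xs + G xs)"
proof -
  have "(Suc ^^ m) k = m + k" for m k
    by (induction m) auto
  then have "total_rec 2 (\<lambda>xs. xs ! 0 + xs ! 1)"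
    using total_rec_iterate[OF computable_Suc] by simp
  then show ?thesis by (rule total_rec_comp2[OF _ assms])
qed

lemma total_rec_if:
  assumes "total_rec n C" "total_rec n F" "total_rec n G"
  shows "total_rec n (\<lambda>xs. if C xs = 0 then F xs else G xs)"
proof -
  \<comment> \<open>Case distinction is a primitive recursion whose step discards both the
    predecessor and the previous value.\<close>
  have rec: "rec_nat a (\<lambda>k r. b) c = (if c = 0 then a else b)" for a b c :: nat
    by (cases c) auto
  \<comment> \<open>The step receives predecessor, previous value and the two branches in this
    order, so index 3 is the second branch.\<close>
  have "total_rec (Suc (Suc 2)) (\<lambda>xs. xs ! 3)"
    by (intro total_rec_nth) simp
  from total_rec_PrimRec[OF total_rec_nth[of 0 2] this]
  have "total_rec (length [C, F, G]) (\<lambda>xs. rec_nat (tl xs ! 0) (\<lambda>k r. tl xs ! 1) (hd xs))"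
    by (simp add: numeral_2_eq_2 numeral_3_eq_3)
  from total_rec_Comp[OF this, of n] show ?thesis
    using assms by (auto simp: rec)
qed

lemma computable_pred: "computable (\<lambda>x. x - 1)"
proof -
  have "rec_nat 0 (\<lambda>k r. k) = (\<lambda>x. x - 1)"
  proof
    show "rec_nat 0 (\<lambda>k r. k) x = x - 1" for x by (cases x) auto
  qed
  then show ?thesis
    using computable_rec_nat[of "\<lambda>k r. k" 0] total_rec_nth[of 0 2] by simp
qed

lemma computable_mod2: "computable (\<lambda>x. x mod 2)"
proof -
  have "rec_nat 0 (\<lambda>k r. if r = 0 then 1 else 0) x = x mod 2" for x :: nat
    by (induction x) (auto simp: mod_Suc)
  then have "rec_nat 0 (\<lambda>k r. if r = 0 then 1 else 0) = (\<lambda>x::nat. x mod 2)" by blast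
  moreover have "total_rec 2 (\<lambda>xs. if xs ! 1 = 0 then 1 else 0)"
    by (intro total_rec_if total_rec_nth total_rec_const) simp
  ultimately show ?thesis
    using computable_rec_nat[of "\<lambda>k r. if r = 0 then 1 else 0" 0] by simp
qed

lemma computable_div2: "computable (\<lambda>x. x div 2)"
proof -
  have step: "Suc k div 2 = k div 2 + k mod 2" for k by presburger
  have "rec_nat 0 (\<lambda>k r. r + k mod 2) x = x div 2" for x :: nat
    by (induction x) (simp_all add: step)
  then have "rec_nat 0 (\<lambda>k r. r + k mod 2) = (\<lambda>x::nat. x div 2)" by blast
  moreover have "total_rec 2 (\<lambda>xs. xs ! 1 + (xs ! 0) mod 2)"
    by (intro total_rec_add total_rec_nth total_rec_comp1[OF computable_mod2]) simp_all
  ultimately show ?thesis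
    using computable_rec_nat[of "\<lambda>k r. r + k mod 2" 0] by simp
qed

lemma computable_double: "computable (\<lambda>x. 2 * x)"
  using total_rec_add[OF total_rec_nth total_rec_nth, of 0 1 0]
  by (simp add: total_rec_Suc_0_iff mult_2)

lemma computable_comp: "computable f \<Longrightarrow> computable g \<Longrightarrow> computable (\<lambda>x. f (g x))"
  using total_rec_comp1[of f 1 "\<lambda>xs. g (xs ! 0)"]
  by (simp add: total_rec_Suc_0_iff)

lemma computable_power2_mult: "computable (\<lambda>x. 2 ^ i * x)"
proof (induction i)
  case 0
  show ?case using total_rec_nth[of 0 1] by (simp add: total_rec_Suc_0_iff)
next
  case (Suc i)
  from computable_comp[OF computable_double Suc.IH] show ?case by (simp add: mult.assoc)
qed

section \<open>C.e. sets of strings\<close>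

text \<open>Searching for the least \<open>y\<close> halts exactly when a witness exists; as
  \<open>t\<close> is total, the search never gets stuck on an undefined value.\<close>

lemma ce_projection:
  assumes "total_rec 2 (\<lambda>xs. t (xs ! 0) (xs ! 1))"
  shows "ce {z. \<exists>y. t y z = 0}"
proof -
  obtain p where "\<And>xs. length xs = 2 \<Longrightarrow> eval p xs = Some (t (xs ! 0) (xs ! 1))"
    using assms unfolding total_rec_def by blast
  then have p: "eval p [y, z] = Some (t y z)" for y z
    by simp
  have "{z. \<exists>y. t y z = 0} = dom (\<lambda>z. eval (Mu p) [z])"
    by (auto simp: p dom_def)
  then show ?thesis
    unfolding ce_def partial_computable_def
    by (intro exI[of _ "\<lambda>z. eval (Mu p) [z]"] conjI exI[of _ "Mu p"] allI refl)
qed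

text \<open>Removes the least significant digit, whether 1 or 2. Truncated subtraction sends 0 to 0,
  in accordance with \<open>tl [] = []\<close>.\<close>

definition code_tl :: "nat \<Rightarrow> nat" where
  "code_tl z = (z - 1) div 2"

lemma computable_code_tl: "computable code_tl"
  using computable_comp[OF computable_div2 computable_pred] by (simp add: code_tl_def[abs_def])

lemma code_tl_str_code: "code_tl (str_code \<sigma>) = str_code (tl \<sigma>)"
  by (cases \<sigma>) (auto simp: code_tl_def)

lemma code_tl_funpow: "(code_tl ^^ n) (str_code \<sigma>) = str_code (drop n \<sigma>)"
  by (induction n) (auto simp: code_tl_str_code tl_drop drop_Suc)

lemma str_code_eq_0_iff: "str_code \<sigma> = 0 \<longleftrightarrow> \<sigma> = []"
  by (cases \<sigma>) auto

text \<open>Only the leading digit affects parity, and it is 2 for \<open>True\<close> and 1 for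
  \<open>False\<close>.\<close>

lemma even_str_code_drop: "n < length \<sigma> \<Longrightarrow> even (str_code (drop n \<sigma>)) \<longleftrightarrow> \<sigma> ! n"
  by (auto simp flip: Cons_nth_drop_Suc)

definition splitting :: "(nat \<Rightarrow> nat) \<Rightarrow> (nat \<Rightarrow> nat) \<Rightarrow> bool list set" where
  "splitting g h = {\<sigma>. \<exists>y. g y < length \<sigma> \<and> h y < length \<sigma> \<and> \<sigma> ! g y \<noteq> \<sigma> ! h y}"

lemma ce_strings_splitting:
  assumes "computable g" "computable h"
  shows "ce_strings (splitting g h)"
proof -
  \<comment> \<open>The value is 0 exactly when \<open>y\<close> is a witness for the string coded
    by \<open>z\<close>: nonzero iterates mean that both positions lie inside the string, and an odd
    sum means that the two bits differ.\<close>
  define t where "t y z =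
    (if (code_tl ^^ g y) z = 0 then 1
     else if (code_tl ^^ h y) z = 0 then 1
     else if ((code_tl ^^ g y) z + (code_tl ^^ h y) z) mod 2 = 0 then 1 else (0::nat))" for y z
  have "total_rec 2 (\<lambda>xs. t (xs ! 0) (xs ! 1))"
    unfolding t_def
    by (intro total_rec_if total_rec_comp1[OF computable_mod2] total_rec_add total_rec_const
        total_rec_comp2[OF total_rec_iterate[OF computable_code_tl]]
        total_rec_comp1[OF assms(1)] total_rec_comp1[OF assms(2)] total_rec_nth) simp_all
  then have "ce {z. \<exists>y. t y z = 0}"
    by (rule ce_projection)
  moreover have "{z. \<exists>y. t y z = 0} = str_code ` splitting g h"
  proof -
    have "(\<exists>y. t y (str_code \<sigma>) = 0) \<longleftrightarrow> \<sigma> \<in> splitting g h" for \<sigma>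
      by (auto simp: t_def splitting_def code_tl_funpow str_code_eq_0_iff
          even_str_code_drop not_le simp flip: even_iff_mod_2_eq_zero)
    then have "str_code \<sigma> \<in> {z. \<exists>y. t y z = 0} \<longleftrightarrow> str_code \<sigma> \<in> str_code ` splitting g h" for \<sigma>
      using bij_is_inj[OF bij_str_code] by (simp add: inj_image_mem_iff)
    \<comment> \<open>Every number codes a string, so comparing the two sets on codes
      suffices.\<close>
    then show ?thesis
      by (metis bij_pointE[OF bij_str_code] set_eqI)
  qed
  ultimately show ?thesis by (simp add: ce_strings_def)
qed

section \<open>Genericity forces agreement at large values\<close>

lemma one_generic_eq_above:
  assumes "one_generic A" "computable g" "computable h" "\<And>y. g y \<in> A \<longleftrightarrow> h y \<in> A"
  obtains n where "\<And>y. g y \<ge> n \<or> h y \<ge> n \<Longrightarrow> g y = h y"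
proof -
  have seg: "length (initial_segment A n) = n"
    "i < n \<Longrightarrow> initial_segment A n ! i \<longleftrightarrow> i \<in> A" for n i
    by (auto simp: initial_segment_def)
  \<comment> \<open>\<open>A\<close> itself never separates \<open>g y\<close> from
    \<open>h y\<close>, so only the second alternative of genericity remains.\<close>
  have "initial_segment A n \<notin> splitting g h" for n
    using assms(4) by (auto simp: splitting_def seg)
  then obtain n where n: "\<And>\<tau>. prefix (initial_segment A n) \<tau> \<Longrightarrow> \<tau> \<notin> splitting g h"
    using assms(1) ce_strings_splitting[OF assms(2,3)] unfolding one_generic_def by blast
  have "g y = h y" if "g y \<ge> n \<or> h y \<ge> n" for y
  proof (rule ccontr)
    assume ne: "g y \<noteq> h y"
    \<comment> \<open>The segment of \<open>A\<close> up to the larger position \<open>m\<close> is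
      continued by the bit opposite to the one at \<open>l\<close>. This splits \<open>g y\<close>
      from \<open>h y\<close>, and \<open>n \<le> m\<close> makes the string an extension of the
      segment of length \<open>n\<close>.\<close>
    define m where "m = max (g y) (h y)"
    define l where "l = min (g y) (h y)"
    define \<tau> where "\<tau> = initial_segment A m @ [l \<notin> A]"
    have "n \<le> m" "l < m" using that ne by (auto simp: m_def l_def)
    then have "[0..<m] = [0..<n] @ [n..<m]"
      using upt_add_eq_append[of 0 n "m - n"] by simp
    then have "prefix (initial_segment A n) \<tau>"
      by (auto simp: \<tau>_def initial_segment_def prefix_def)
    moreover have "\<tau> ! m \<noteq> \<tau> ! l" "length \<tau> = Suc m"
      using \<open>l < m\<close> by (simp_all add: \<tau>_def nth_append seg)
    then have "\<tau> \<in> splitting g h"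
      using ne
      by (auto simp: splitting_def m_def l_def max_def min_def split: if_splits intro!: exI[of _ y])
    ultimately show False using n by blast
  qed
  then show thesis by (rule that)
qed

section \<open>The fold maps and the antichain\<close>

text \<open>The even arguments already hit every \<open>x\<close> once, at \<open>2 * x\<close>;
  each odd \<open>y\<close> adds a second preimage to \<open>2 ^ i * y\<close>.\<close>

definition fold_map :: "nat \<Rightarrow> nat \<Rightarrow> nat" where
  "fold_map i y = (if even y then y div 2 else 2 ^ i * y)"

lemma computable_fold_map: "computable (fold_map i)"
proof -
  have "total_rec 1 (\<lambda>xs. if (xs ! 0) mod 2 = 0 then (xs ! 0) div 2 else 2 ^ i * (xs ! 0))"
    by (intro total_rec_if total_rec_comp1[OF computable_mod2] total_rec_comp1[OF computable_div2]
        total_rec_comp1[OF computable_power2_mult] total_rec_nth) simp_all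
  then have "total_rec (Suc 0) (\<lambda>xs. fold_map i (xs ! 0))"
    by (simp add: fold_map_def even_iff_mod_2_eq_zero)
  then show ?thesis
    by (simp add: total_rec_Suc_0_iff)
qed

lemma odd_power2_mult_eq:
  assumes "odd y" "odd z" "2 ^ i * y = 2 ^ j * (z::nat)"
  shows "i = j"
  using assms
proof (induction i arbitrary: j)
  case 0
  then show ?case by (cases j) auto
next
  case (Suc i)
  then show ?case by (cases j) auto
qed

text \<open>An odd \<open>x\<close> would give \<open>2 ^ j * x = 2 ^ i * y\<close> with both
  cofactors odd, hence \<open>i = j\<close>. So the fibre contains only the even preimage.\<close>

lemma fold_map_eq_unique:
  assumes "i \<noteq> j" "odd y" "fold_map j x = 2 ^ i * y"
  shows "x = 2 * (2 ^ i * y)"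
  using assms odd_power2_mult_eq[of x y j i] by (auto simp: fold_map_def split: if_splits)

text \<open>The map itself reduces the preimage to \<open>A\<close>, and its section, doubling,
  reduces \<open>A\<close> to the preimage.\<close>

lemma vimage_fold_map_many_one_equiv: "fold_map i -` A \<equiv>\<^sub>m A"
proof -
  have "x \<in> A \<longleftrightarrow> 2 * x \<in> fold_map i -` A" for x
    by (simp add: fold_map_def)
  then show ?thesis
    unfolding many_one_equiv_def many_one_reducible_def
    by (intro conjI exI[of _ "fold_map i"] exI[of _ "\<lambda>x. 2 * x"] allI computable_fold_map
        computable_double) simp_all
qed

lemma vimage_fold_map_not_one_one_reducible:
  assumes "one_generic A" "i \<noteq> j"
  shows "\<not> fold_map i -` A \<le>\<^sub>1 fold_map j -` A"
proof
  assume "fold_map i -` A \<le>\<^sub>1 fold_map j -` A"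
  then obtain f where f: "computable f" "inj f" "\<And>x. fold_map i x \<in> A \<longleftrightarrow> fold_map j (f x) \<in> A"
    unfolding one_one_reducible_def by auto
  obtain n where n:
    "\<And>x. fold_map i x \<ge> n \<or> fold_map j (f x) \<ge> n \<Longrightarrow> fold_map i x = fold_map j (f x)"
    using one_generic_eq_above[OF assms(1) computable_fold_map
        computable_comp[OF computable_fold_map f(1)] f(3)] by blast
  \<comment> \<open>Oddness of \<open>y\<close> gives \<open>x\<close> two preimages under
    \<open>fold_map i\<close>; its size puts \<open>x\<close> beyond the bound
    \<open>n\<close>.\<close>
  define y where "y = Suc (2 * n)"
  define x where "x = 2 ^ i * y"
  have "odd y" by (simp add: y_def)
  have "y \<le> x" by (simp add: x_def)
  then have "n \<le> x" by (simp add: y_def)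
  have fib: "fold_map i y = x" "fold_map i (2 * x) = x"
    using \<open>odd y\<close> by (simp_all add: fold_map_def x_def)
  then have "fold_map j (f y) = x" "fold_map j (f (2 * x)) = x"
    using n \<open>n \<le> x\<close> by metis+
  \<comment> \<open>Both preimages of \<open>x\<close> are sent into a fibre of
    \<open>fold_map j\<close> with a single element, so injectivity of \<open>f\<close> identifies
    an odd number with an even one.\<close>
  then have "f y = f (2 * x)"
    using fold_map_eq_unique[OF assms(2) \<open>odd y\<close>] unfolding x_def by metis
  then have "y = 2 * x" using f(2) by (simp add: inj_eq)
  with \<open>odd y\<close> show False by simp
qed

theorem corollary4p5:
  fixes A :: "nat set"
  assumes "one_generic A"
  shows "\<exists>B :: nat \<Rightarrow> nat set.
           (\<forall>i. B i \<in> many_one_degree A) \<and> (\<forall>i j. i \<noteq> j \<longrightarrow> \<not> B i \<le>\<^sub>1 B j)"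
  using vimage_fold_map_many_one_equiv vimage_fold_map_not_one_one_reducible[OF assms]
  by (intro exI[of _ "\<lambda>i. fold_map i -` A"]) (simp add: many_one_degree_def)

end
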